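(* Let $G=(V,E)$ be a finite connected graph of girth at least $7$, with $n$ vertices and $m$ edges, and let $\gamma(G)$ denote its domination number. Then either $\gamma(G)=1$ or $\gamma(G) \geq \frac{1}{2}\left(3+\sqrt{8(m-n)+9}\right)$. Moreover, if the minimum degree of $G$ is $2$, then $\gamma(G) \geq \max\left\{\sqrt{n}, \sqrt{\tfrac{2m}{3}}\right\}$.
   Context: The domination number $\gamma(G)$ is the minimum cardinality of a set $D \subseteq V$ such that every vertex of $V\setminus D$ is adjacent to some vertex of $D$. The girth of a graph is the length of its shortest cycle (taken to be infinite if the graph has no cycle). *)

theory Defs
  imports Complex_Main "HOL-Library.Extended_Nat"
begin

definition fin_simple_graph :: "'a set \<Rightarrow> 'a set set \<Rightarrow> bool" where
  "fin_simple_graph V E \<longleftrightarrow> finite V \<and> (\<forall>e\<in>E. e \<subseteq> V \<and> card e = 2)"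

definition adj :: "'a set set \<Rightarrow> 'a \<Rightarrow> 'a \<Rightarrow> bool" where
  "adj E u v \<longleftrightarrow> {u, v} \<in> E"

definition walk :: "'a set \<Rightarrow> 'a set set \<Rightarrow> 'a list \<Rightarrow> bool" where
  "walk V E xs \<longleftrightarrow> xs \<noteq> [] \<and> set xs \<subseteq> V \<and> successively (adj E) xs"

text \<open>The graph without vertices does not count as connected.\<close>

definition graph_connected :: "'a set \<Rightarrow> 'a set set \<Rightarrow> bool" where
  "graph_connected V E \<longleftrightarrow>
     V \<noteq> {} \<and> (\<forall>u\<in>V. \<forall>v\<in>V. \<exists>xs. walk V E xs \<and> hd xs = u \<and> last xs = v)"

text \<open>A cycle is given by the list of its pairwise distinct vertices; the start vertex is
  not repeated at the end, so the length of the list is the number of edges of the cycle.\<close>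

definition graph_cycle :: "'a set \<Rightarrow> 'a set set \<Rightarrow> 'a list \<Rightarrow> bool" where
  "graph_cycle V E xs \<longleftrightarrow>
     walk V E xs \<and> 3 \<le> length xs \<and> distinct xs \<and> adj E (last xs) (hd xs)"

text \<open>The infimum over the empty set is \<open>\<infinity>\<close>, which is the girth of an acyclic graph.\<close>

definition girth :: "'a set \<Rightarrow> 'a set set \<Rightarrow> enat" where
  "girth V E = (INF xs\<in>{xs. graph_cycle V E xs}. enat (length xs))"

definition dominating_set :: "'a set \<Rightarrow> 'a set set \<Rightarrow> 'a set \<Rightarrow> bool" where
  "dominating_set V E D \<longleftrightarrow> D \<subseteq> V \<and> (\<forall>v\<in>V - D. \<exists>d\<in>D. adj E v d)"

definition domination_number :: "'a set \<Rightarrow> 'a set set \<Rightarrow> nat" where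
  "domination_number V E = Min (card ` {D. dominating_set V E D})"

definition degree :: "'a set set \<Rightarrow> 'a \<Rightarrow> nat" where
  "degree E v = card {e \<in> E. v \<in> e}"

definition min_degree :: "'a set \<Rightarrow> 'a set set \<Rightarrow> nat" where
  "min_degree V E = Min (degree E ` V)"

end

theory Submission
  imports Defs
begin

text \<open>A minimum dominating set \<open>D\<close> partitions the graph into \<open>\<gamma>\<close> stars with \<open>n - \<gamma>\<close> edges in
  total. A further edge inside a star closes a triangle, and two further edges between the same
  two stars close a cycle of length at most 6. So at most \<open>\<gamma> choose 2\<close> edges lie outside
  the stars, and \<open>m \<le> n - \<gamma> + \<gamma>(\<gamma> - 1) / 2\<close>, which is the first bound. If all degrees are at
  least 2, every vertex outside \<open>D\<close> lies on an edge outside the stars, so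
  \<open>n - \<gamma> \<le> \<gamma>(\<gamma> - 1)\<close>, which is \<open>n \<le> \<gamma>\<^sup>2\<close>; with the bound on \<open>m\<close> this gives
  \<open>m \<le> 3\<gamma>\<^sup>2 / 2\<close>.\<close>

lemma adj_sym: "adj E u v \<Longrightarrow> adj E v u"
  by (simp add: adj_def insert_commute)

lemma girth_le_length: "graph_cycle V E xs \<Longrightarrow> girth V E \<le> enat (length xs)"
  unfolding girth_def by (rule INF_lower) simp

lemma minimum_dominating_set:
  assumes "finite V"
  obtains D where "dominating_set V E D" "card D = domination_number V E"
proof -
  have "finite {D. dominating_set V E D}"
    by (rule finite_subset[of _ "Pow V"]) (auto simp: dominating_set_def assms)
  moreover have "dominating_set V E V"
    by (simp add: dominating_set_def)
  ultimately have "Min (card ` {D. dominating_set V E D}) \<in> card ` {D. dominating_set V E D}"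
    by (intro Min_in) auto
  then show thesis
    using that by (auto simp: domination_number_def)
qed

text \<open>The map \<open>f\<close> encodes the stars: its fibre over a centre \<open>d\<close> in
  \<open>D\<close> is the star of \<open>d\<close>. Each vertex outside \<open>D\<close> commits to
  one neighbour in \<open>D\<close>, even if it has several.\<close>

locale star_partition =
  fixes V :: "'a set" and E :: "'a set set" and D :: "'a set" and f :: "'a \<Rightarrow> 'a"
  assumes simple: "fin_simple_graph V E"
    and girth7: "girth V E \<ge> 7"
    and D_subset: "D \<subseteq> V"
    and centre_in: "v \<in> V \<Longrightarrow> f v \<in> D"
    and centre_fix: "v \<in> D \<Longrightarrow> f v = v"
    and centre_adj: "v \<in> V - D \<Longrightarrow> adj E v (f v)"
begin

definition star_edges :: "'a set set" where
  "star_edges = (\<lambda>v. {v, f v}) ` (V - D)"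

text \<open>That these edges join different stars is not built in; it follows from the girth in
  \<open>centres_of_cross_edge_distinct\<close>.\<close>

definition cross_edges :: "'a set set" where
  "cross_edges = E - star_edges"

lemma finite_V: "finite V" and edge_subset: "e \<in> E \<Longrightarrow> e \<subseteq> V" and card_edge: "e \<in> E \<Longrightarrow> card e = 2"
  using simple by (auto simp: fin_simple_graph_def)

lemma finite_E: "finite E"
  using finite_V edge_subset by (meson Pow_iff finite_Pow_iff finite_subset subsetI)

lemma finite_D: "finite D"
  using D_subset finite_V finite_subset by blast

lemma cycle_length_ge7: "graph_cycle V E xs \<Longrightarrow> 7 \<le> length xs"
  using girth7 girth_le_length[of V E xs] by (metis enat_ord_simps(1) numeral_eq_enat order_trans)

lemma card_star_edges: "card star_edges = card V - card D"
proof -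
  \<comment> \<open>As \<open>f v\<close> is in \<open>D\<close>, the vertex \<open>v\<close> is the
    only end of its star edge outside \<open>D\<close>.\<close>
  have "inj_on (\<lambda>v. {v, f v}) (V - D)"
    using centre_in by (auto simp: inj_on_def doubleton_eq_iff)
  then show ?thesis
    using D_subset finite_D by (simp add: star_edges_def card_image card_Diff_subset)
qed

lemma star_edges_subset: "star_edges \<subseteq> E"
  using centre_adj by (auto simp: star_edges_def adj_def)

lemma card_E: "card E + card D = card V + card cross_edges"
proof -
  have "card cross_edges = card E - card star_edges" "card star_edges \<le> card E"
    using star_edges_subset finite_E
    by (simp_all add: cross_edges_def card_Diff_subset finite_subset card_mono)
  moreover have "card D \<le> card V"
    using D_subset finite_V by (rule card_mono[rotated])
  ultimately show ?thesis
    using card_star_edges by simp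
qed

text \<open>Any two vertices of a star are equal, adjacent, or joined through the centre. The path
  stays inside the star so that paths in different stars are disjoint; lengths count
  vertices.\<close>

lemma star_path:
  assumes "a \<in> V" "b \<in> V" "f a = f b"
  obtains P where "walk V E P" "hd P = a" "last P = b" "distinct P" "length P \<le> 3"
    "a \<noteq> b \<longrightarrow> 2 \<le> length P" "\<forall>x\<in>set P. f x = f a"
proof -
  define c where "c = f a"
  have c: "c \<in> D" "f c = c" "c \<in> V"
    using centre_in centre_fix D_subset assms by (auto simp: c_def)
  have adj_a: "a \<noteq> c \<Longrightarrow> adj E a c" and adj_b: "b \<noteq> c \<Longrightarrow> adj E c b"
    using assms centre_fix centre_adj adj_sym unfolding c_def by (metis DiffI)+
  consider "a = b" | "a \<noteq> b" "a = c \<or> b = c" | "a \<noteq> b" "a \<noteq> c" "b \<noteq> c"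
    by blast
  then show thesis
  proof cases
    case 1
    then show ?thesis using that[of "[a]"] assms by (simp add: walk_def)
  next
    case 2
    then have "adj E a b"
      using adj_a adj_b by metis
    then show ?thesis using that[of "[a, b]"] assms 2 by (simp add: walk_def)
  next
    case 3
    moreover have "f a = c" "f b = c"
      using assms by (simp_all add: c_def)
    ultimately show ?thesis
      using that[of "[a, c, b]"] assms(1,2) adj_a adj_b c(2,3) by (simp add: walk_def)
  qed
qed

lemma centres_of_cross_edge_distinct:
  assumes "{a, b} \<in> cross_edges"
  shows "f a \<noteq> f b"
proof
  assume eq: "f a = f b"
  have e: "{a, b} \<in> E" and ns: "{a, b} \<notin> star_edges"
    using assms by (auto simp: cross_edges_def)
  have V: "a \<in> V" "b \<in> V" and ne: "a \<noteq> b"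
    using edge_subset[OF e] card_edge[OF e] by auto
  have star: "v \<in> D \<or> {v, f v} \<in> star_edges" if "v \<in> V" for v
    using that by (auto simp: star_edges_def)
  \<comment> \<open>If \<open>a\<close> were the centre, then \<open>b\<close> would lie in
    \<open>D\<close> and equal \<open>a\<close>, or \<open>{b, a}\<close> would be the star edge of
    \<open>b\<close>. The same holds with \<open>a\<close> and \<open>b\<close> exchanged.\<close>
  have "a \<noteq> f a"
    using star[OF V(2)] centre_fix[of b] ns ne eq by (auto simp: insert_commute)
  moreover have "b \<noteq> f a"
    using star[OF V(1)] centre_fix[of a] ns ne by auto
  moreover from calculation have "adj E a (f a)" "adj E b (f a)"
    using centre_adj centre_fix V eq by (metis DiffI)+
  ultimately have "graph_cycle V E [a, b, f a]"
    using V ne e centre_in[OF V(1)] D_subset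
    by (auto simp: graph_cycle_def walk_def adj_def insert_commute)
  then show False
    using cycle_length_ge7 by force
qed

text \<open>Otherwise a path from \<open>a\<close> to \<open>a'\<close> in one star and a path from
  \<open>b'\<close> to \<open>b\<close> in the other, each on at most 3 vertices, form with the two
  cross edges a cycle that is too short.\<close>

lemma cross_edge_unique:
  assumes "{a, b} \<in> cross_edges" "{a', b'} \<in> cross_edges" "f a = f a'" "f b = f b'"
  shows "a = a' \<and> b = b'"
proof (rule ccontr)
  assume ne: "\<not> (a = a' \<and> b = b')"
  have e: "{a, b} \<in> E" "{a', b'} \<in> E"
    using assms by (auto simp: cross_edges_def)
  then have V: "a \<in> V" "b \<in> V" "a' \<in> V" "b' \<in> V"
    using edge_subset by blast+
  obtain P where P: "walk V E P" "hd P = a" "last P = a'" "distinct P" "length P \<le> 3"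
    "a \<noteq> a' \<longrightarrow> 2 \<le> length P" "\<forall>x\<in>set P. f x = f a"
    using star_path[OF V(1,3) assms(3)] .
  obtain Q where Q: "walk V E Q" "hd Q = b'" "last Q = b" "distinct Q" "length Q \<le> 3"
    "b' \<noteq> b \<longrightarrow> 2 \<le> length Q" "\<forall>x\<in>set Q. f x = f b'"
    using star_path[OF V(4,2) assms(4)[symmetric]] .
  have nonempty: "P \<noteq> []" "Q \<noteq> []"
    using P(1) Q(1) by (auto simp: walk_def)
  have "f a \<noteq> f b'"
    using centres_of_cross_edge_distinct[OF assms(1)] assms(4) by simp
  then have "distinct (P @ Q)"
    using P Q by force
  moreover have "walk V E (P @ Q)"
    using P Q e nonempty by (auto simp: walk_def successively_append_iff adj_def)
  \<comment> \<open>The cross edges may share one end, but not both, so at least one of the two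
    paths has two vertices.\<close>
  moreover have "3 \<le> length (P @ Q)"
    using ne P(6) Q(6) nonempty by (cases P; cases Q) auto
  ultimately have "graph_cycle V E (P @ Q)"
    using P(2) Q(3) e nonempty by (simp add: graph_cycle_def adj_def insert_commute)
  then show False
    using cycle_length_ge7 P(5) Q(5) by force
qed

lemma card_cross_edges: "card cross_edges \<le> card D choose 2"
proof -
  have pair: "\<exists>a b. e = {a, b}" if "e \<in> cross_edges" for e
    using that card_edge unfolding cross_edges_def card_2_iff by blast
  \<comment> \<open>A cross edge is sent to the unordered pair of its centres; equal pairs may match
    in either order.\<close>
  have "inj_on (\<lambda>e. f ` e) cross_edges"
  proof (rule inj_onI)
    fix e e' assume e: "e \<in> cross_edges" "e' \<in> cross_edges" "f ` e = f ` e'"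
    obtain a b a' b' where ab: "e = {a, b}" "e' = {a', b'}"
      using pair e by meson
    then consider "f a = f a'" "f b = f b'" | "f a = f b'" "f b = f a'"
      using e by (auto simp: doubleton_eq_iff)
    then show "e = e'"
      using cross_edge_unique e ab by cases (metis insert_commute)+
  qed
  moreover have "(\<lambda>e. f ` e) ` cross_edges \<subseteq> {K. K \<subseteq> D \<and> card K = 2}"
  proof
    fix K assume "K \<in> (\<lambda>e. f ` e) ` cross_edges"
    then obtain e where e: "e \<in> cross_edges" "K = f ` e"
      by blast
    then obtain a b where ab: "e = {a, b}"
      using pair by blast
    have "f ` e \<subseteq> D"
      using e centre_in edge_subset by (fastforce simp: cross_edges_def)
    moreover have "card (f ` e) = 2"
      using centres_of_cross_edge_distinct e ab by simp
    ultimately show "K \<in> {K. K \<subseteq> D \<and> card K = 2}"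
      using e by simp
  qed
  moreover have "finite {K. K \<subseteq> D \<and> card K = 2}"
    using finite_D by (simp add: finite_Collect_subsets)
  ultimately show ?thesis
    using card_inj_on_le n_subsets[OF finite_D] by metis
qed

lemma card_V_le:
  assumes "\<And>v. v \<in> V \<Longrightarrow> 2 \<le> degree E v"
  shows "card V \<le> card D + 2 * card cross_edges"
proof -
  have "V - D \<subseteq> \<Union> cross_edges"
  proof
    fix v assume v: "v \<in> V - D"
    \<comment> \<open>Two incident edges do not fit into a singleton, so some edge at
      \<open>v\<close> differs from its own star edge.\<close>
    have "\<not> {e \<in> E. v \<in> e} \<subseteq> {{v, f v}}"
      using assms[of v] v card_mono[of "{{v, f v}}" "{e \<in> E. v \<in> e}"] by (auto simp: degree_def)
    then obtain e where e: "e \<in> E" "v \<in> e" "e \<noteq> {v, f v}"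
      by blast
    \<comment> \<open>The star edge of another vertex \<open>w\<close> misses \<open>v\<close>,
      because its second end \<open>f w\<close> lies in \<open>D\<close>.\<close>
    then have "e \<notin> star_edges"
      using v centre_in by (auto simp: star_edges_def)
    then show "v \<in> \<Union> cross_edges"
      using e by (auto simp: cross_edges_def)
  qed
  moreover have "finite (\<Union> cross_edges)"
    by (rule finite_subset[OF _ finite_V]) (auto simp: cross_edges_def dest: edge_subset)
  ultimately have "card (V - D) \<le> card (\<Union> cross_edges)"
    by (rule card_mono[rotated])
  also have "\<dots> \<le> (\<Sum>e\<in>cross_edges. card e)"
    by (rule card_Union_le_sum_card)
  also have "\<dots> = 2 * card cross_edges"
    using card_edge by (simp add: cross_edges_def)
  finally show ?thesis
    using D_subset finite_D by (simp add: card_Diff_subset)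
qed

end

theorem theorem2:
  fixes V :: "'a set" and E :: "'a set set" and n m \<gamma> :: nat
  assumes "fin_simple_graph V E"
    and "graph_connected V E"
    and "girth V E \<ge> 7"
    and "n = card V"
    and "m = card E"
    and "\<gamma> = domination_number V E"
  shows "(\<gamma> = 1 \<or> real \<gamma> \<ge> 1 / 2 * (3 + sqrt (8 * (real m - real n) + 9))) \<and>
    (min_degree V E = 2 \<longrightarrow> real \<gamma> \<ge> max (sqrt (real n)) (sqrt (2 * real m / 3)))"
proof -
  have finV: "finite V" and nonempty: "V \<noteq> {}"
    using assms(1,2) by (auto simp: fin_simple_graph_def graph_connected_def)
  obtain D where D: "dominating_set V E D" "card D = \<gamma>"
    using minimum_dominating_set[OF finV] assms(6) by metis
  define f where "f v = (if v \<in> D then v else SOME d. d \<in> D \<and> adj E v d)" for v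
  have f: "f v \<in> D \<and> adj E v (f v)" if "v \<in> V - D" for v
    using that D(1) someI_ex[of "\<lambda>d. d \<in> D \<and> adj E v d"] by (auto simp: f_def dominating_set_def)
  interpret star_partition V E D f
  proof
    show "D \<subseteq> V"
      using D(1) by (simp add: dominating_set_def)
    show "f v \<in> D" if "v \<in> V" for v
      using f[of v] that by (cases "v \<in> D") (auto simp: f_def)
  qed (use assms f in \<open>auto simp: f_def\<close>)
  have "D \<noteq> {}"
    using nonempty centre_in by blast
  then have pos: "\<gamma> \<ge> 1"
    using D(2) finite_D by (metis One_nat_def Suc_leI card_gt_0_iff)
  have "2 * card cross_edges \<le> 2 * (\<gamma> choose 2)"
    using card_cross_edges D(2) by simp
  also have "\<dots> = \<gamma> * (\<gamma> - 1)"
    by (cases \<gamma>) (simp_all add: choose_two del: mult_Suc)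
  finally have "real (2 * card cross_edges) \<le> real (\<gamma> * (\<gamma> - 1))"
    by (rule of_nat_mono)
  then have cross: "2 * real (card cross_edges) \<le> real \<gamma> ^ 2 - real \<gamma>"
    using pos by (simp add: of_nat_diff power2_eq_square algebra_simps)
  have m: "real m + real \<gamma> = real n + real (card cross_edges)"
    using card_E D(2) assms(4,5) by (metis of_nat_add)
  have "real \<gamma> \<ge> 1 / 2 * (3 + sqrt (8 * (real m - real n) + 9))" if "\<gamma> \<noteq> 1"
  proof -
    \<comment> \<open>Eliminating the cross edges gives
      \<open>2 * (m - n) \<le> \<gamma>^2 - 3 * \<gamma>\<close>; multiplying by 4 and adding 9
      completes the square.\<close>
    have "8 * (real m - real n) + 9 \<le> (2 * real \<gamma> - 3) ^ 2"
      using m cross by (simp add: power2_eq_square algebra_simps)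
    then have "sqrt (8 * (real m - real n) + 9) \<le> 2 * real \<gamma> - 3"
      \<comment> \<open>Here \<open>\<gamma> \<noteq> 1\<close> enters:
        \<open>\<gamma> \<ge> 2\<close> makes \<open>2 * \<gamma> - 3\<close> nonnegative, so the
        root can be taken.\<close>
      using pos that by (intro real_le_lsqrt) auto
    then show ?thesis
      by simp
  qed
  moreover have "real \<gamma> \<ge> max (sqrt (real n)) (sqrt (2 * real m / 3))" if "min_degree V E = 2"
  proof -
    have "2 \<le> degree E v" if "v \<in> V" for v
      using that \<open>min_degree V E = 2\<close> finV Min_le[of "degree E ` V" "degree E v"]
      by (simp add: min_degree_def)
    then have "n \<le> \<gamma> + 2 * card cross_edges"
      using card_V_le D(2) assms(4) by simp
    then have n: "real n \<le> real \<gamma> ^ 2"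
      using cross by linarith
    \<comment> \<open>From \<open>m = n - \<gamma> + card cross_edges\<close> one gets
      \<open>m \<le> 3 / 2 * (\<gamma>^2 - \<gamma>)\<close>.\<close>
    then have "2 * real m / 3 \<le> real \<gamma> ^ 2"
      using m cross by linarith
    with n show ?thesis
      by (simp add: real_le_lsqrt)
  qed
  ultimately show ?thesis
    by blast
qed

end
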